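(* Let $\{x^k\}$ be an infinite sequence generated by Algorithm iBDCA (described in the context). Then every accumulation point of $\{x^k\}$ is a critical point of the DC problem $\min_{x\in\mathcal X}\,G_\rho(x)-H_\rho(x)$.
   Context: Model. Let $n,T\in\mathbb N=\{1,2,\dots\}$. Let $X:=\{z\in\mathbb R^n:\sum_{i=1}^n z_i=1,\ z_i\ge 0,\ i=1,\dots,n\}$ and $\mathcal X:=X^T\subset(\mathbb R^n)^T\cong\mathbb R^{nT}$; elements are written $x=(x^1,\dots,x^T)$ with blocks $x^t\in\mathbb R^n$, and $\|\cdot\|$ is the Euclidean norm. Fix $w_{\mathrm{prev}}\in X$. For each $t=1,\dots,T$ let $S_t\in\mathbb N$ and let $\xi^t$ be a discrete random vector taking values $\xi^t_j\in\mathbb R^n$ with probabilities $p^t_j>0$, $j=1,\dots,S_t$, $\sum_{j=1}^{S_t}p^t_j=1$; put $\mu^t:=\sum_{j=1}^{S_t}p_j^t\xi_j^t$ and $L_j^t(z):=-(\xi_j^t)^\top z$. Fix $\alpha\in(0,1)$, $\lambda_1>0$, $\lambda_2>0$, $c_i\ge 0$ ($i=1,\dots,n$), and $\tau\in\mathbb R$. Let $(a)_+:=\max\{a,0\}$. For a real random variable $L$, $\operatorname{VaR}_\alpha(L):=\inf\{u\in\mathbb R:\mathbb P(L\le u)\ge\alpha\}$. $f(x):=-\sum_{t=1}^T(\mu^t)^\top x^t+\lambda_1\Big[\sum_{i=1}^n c_i|x_i^1-(w_{\mathrm{prev}})_i|+\sum_{t=2}^T\sum_{i=1}^n c_i|x_i^t-x_i^{t-1}|\Big]+\lambda_2\sum_{t=1}^T\|x^t\|^2$;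 $R(x):=\sum_{t=1}^T\big(\operatorname{VaR}_\alpha(-(\xi^t)^\top x^t)-\tau\big)_+$; for $\rho>0$, $\Phi_\rho:=f+\rho R$. DC decomposition. For $\beta\in(0,1)$ let $\psi_{\beta,t}(z):=\min_{u\in\mathbb R}\{u+\frac1{1-\beta}\sum_{j=1}^{S_t}p_j^t(L_j^t(z)-u)_+\}$ (the CVaR at level $\beta$ of $-(\xi^t)^\top z$). Let $\bar\varepsilon_t:=\alpha-\max\{\sum_{j\in J}p_j^t: J\subseteq\{1,\dots,S_t\},\ \sum_{j\in J}p_j^t<\alpha\}$ (empty sum $=0$), fix $0<\gamma<\min_t\bar\varepsilon_t$, and set $A_\gamma:=\frac{1-\alpha+\gamma}{\gamma}$, $B_\gamma:=\frac{1-\alpha}{\gamma}$. Then $\operatorname{VaR}_\alpha(-(\xi^t)^\top z)=A_\gamma\psi_{\alpha-\gamma,t}(z)-B_\gamma\psi_{\alpha,t}(z)$ and $\Phi_\rho=G_\rho-H_\rho$ with $G_\rho(x):=f(x)+\rho\sum_{t=1}^T\max\{A_\gamma\psi_{\alpha-\gamma,t}(x^t)-\tau,\ B_\gamma\psi_{\alpha,t}(x^t)\}$, $H_\rho(x):=\rho B_\gamma\sum_{t=1}^T\psi_{\alpha,t}(x^t)$. For fixed $\nu>0$: $\widehat G_\rho:=G_\rho+\frac\nu2\|\cdot\|^2$, $\widehat H_\rho:=H_\rho+\frac\nu2\|\cdot\|^2$. For convex functions $\partial$ is the convex subdifferential. Critical point: $\bar x\in\mathcal X$ is critical for $\min_{x\in\mathcal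 X}G_\rho(x)-H_\rho(x)$ if $\partial H_\rho(\bar x)\cap(\partial G_\rho(\bar x)+N_{\mathcal X}(\bar x))\neq\varnothing$, where $N_{\mathcal X}(\bar x)=\{v:\langle v,y-\bar x\rangle\le0\ \forall y\in\mathcal X\}$. Algorithm iBDCA. Input: $\rho>0$, $x^{-1}=x^0\in\mathcal X$, $\theta\in[0,1)$, $\nu>0$, $\sigma\in(0,\lambda_2+\nu)$, $\eta\in(0,1)$, $\bar\lambda>1$, $\varepsilon_{\mathrm{tol}}\ge0$. Here superscript $k$ indexes iterates in $\mathcal X$ and $w^{k,t}$ is the $t$-th block of $w^k$; $\Pi_{\mathcal X}$ is Euclidean projection onto $\mathcal X$. For $k=0,1,2,\dots$: 1. $w^k=\Pi_{\mathcal X}(x^k+\theta(x^k-x^{k-1}))$; if $\Phi_\rho(w^k)>\Phi_\rho(x^k)$, reset $w^k=x^k$. 2. For each $t$ compute $g_{\alpha,t}(w^{k,t})=-\frac{1}{1-\alpha}\sum_{j}p_j^t\vartheta_j\xi_j^t\in\partial\psi_{\alpha,t}(w^{k,t})$, where, for a minimizer $u^*$ in the definition of $\psi_{\alpha,t}(w^{k,t})$, $\vartheta_j=1$ if $L_j^t(w^{k,t})>u^*$, $\vartheta_j\in[0,1]$ if $L_j^t(w^{k,t})=u^*$, $\vartheta_j=0$ if $L_j^t(w^{k,t})<u^*$, and $\sum_jp_j^t\vartheta_j=1-\alpha$. Set $s^k=\rho B_\gamma(g_{\alpha,1}(w^{k,1}),\dots,g_{\alpha,T}(w^{k,T}))\in\partial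 H_\rho(w^k)$ and $u^k=s^k+\nu w^k\in\partial\widehat H_\rho(w^k)$. 3. $y^k=\operatorname*{arg\,min}_{x\in\mathcal X}\{\widehat G_\rho(x)-\langle u^k,x\rangle\}$ (unique solution); $d^k=y^k-w^k$. 4. If $\|d^k\|=0$, return $w^k$. If $\varepsilon_{\mathrm{tol}}>0$ and $\|d^k\|\le\varepsilon_{\mathrm{tol}}\max\{1,\|w^k\|\}$, return $w^k$. 5. (Line search) $\lambda_k^{\max}=\max\{\lambda\ge1:w^k+\lambda d^k\in\mathcal X\}$; $\lambda_k=\min\{\bar\lambda,\lambda_k^{\max}\}$. While $\lambda_k>1$ and $\Phi_\rho(w^k+\lambda_kd^k)>\min\{\Phi_\rho(y^k),\ \Phi_\rho(w^k)-\sigma\lambda_k^2\|d^k\|^2\}$, set $\lambda_k=\max\{1,\eta\lambda_k\}$. 6. $x^{k+1}=w^k+\lambda_kd^k$. "Infinite sequence generated" means the algorithm never returns. *)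

theory Defs
  imports "HOL-Probability.Probability" "HOL-Library.While_Combinator"
begin

definition subdifferential :: "('a::real_inner \<Rightarrow> real) \<Rightarrow> 'a \<Rightarrow> 'a set" where
  "subdifferential f x = {s. \<forall>y. f y \<ge> f x + s \<bullet> (y - x)}"

definition normal_cone :: "'a::real_inner set \<Rightarrow> 'a \<Rightarrow> 'a set" where
  "normal_cone C x = {v. \<forall>y\<in>C. v \<bullet> (y - x) \<le> 0}"

definition dc_critical_point ::
    "'a::real_inner set \<Rightarrow> ('a \<Rightarrow> real) \<Rightarrow> ('a \<Rightarrow> real) \<Rightarrow> 'a \<Rightarrow> bool" where
  "dc_critical_point C G H x \<longleftrightarrow>
     x \<in> C \<and>
     subdifferential H x \<inter> {a + b | a b. a \<in> subdifferential G x \<and> b \<in> normal_cone C x} \<noteq> {}"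

definition value_at_risk :: "real \<Rightarrow> 'w measure \<Rightarrow> ('w \<Rightarrow> real) \<Rightarrow> real" where
  "value_at_risk \<alpha> M L = Inf {u. measure M {\<omega> \<in> space M. L \<omega> \<le> u} \<ge> \<alpha>}"

definition weight_simplex :: "(real^'n) set" where
  "weight_simplex = {z. (\<Sum>i\<in>UNIV. z $ i) = 1 \<and> (\<forall>i. 0 \<le> z $ i)}"

definition feasible :: "(real^'n^'t) set" where
  "feasible = {x. \<forall>t. x $ t \<in> weight_simplex}"

text \<open>
  The periods $1,\dots,T$ are the elements of a finite linearly ordered index type, so that
  \<open>Min UNIV\<close> is the first period and \<open>Max {s. s < t}\<close> the period preceding a later period \<open>t\<close>.
  The norm and inner product of \<^typ>\<open>real^'n^'t\<close> are the Euclidean ones.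

  The random return vector of period \<open>t\<close> is \<open>\<xi> t\<close>; its scenarios are \<open>r t j\<close> with
  probabilities \<open>p t j\<close>, for \<open>j\<close> from \<open>1\<close> to \<open>S t\<close>. In the assumption on its law, the sum
  is just \<open>p t j\<close> at \<open>v = r t j\<close> when the scenarios are pairwise distinct; coinciding
  scenarios are allowed and their probabilities add up.
\<close>

locale portfolio = prob_space M for M :: "'w measure" +
  fixes \<xi> :: "'t::{finite,linorder} \<Rightarrow> 'w \<Rightarrow> real^'n"
    and S :: "'t \<Rightarrow> nat"
    and r :: "'t \<Rightarrow> nat \<Rightarrow> real^'n"
    and p :: "'t \<Rightarrow> nat \<Rightarrow> real"
    and \<alpha> lam1 lam2 :: real
    and c w_prev :: "real^'n"
    and \<tau> :: real
    and \<gamma> :: real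
  assumes w_prev: "w_prev \<in> weight_simplex"
    and S_pos: "\<And>t. S t \<ge> 1"
    and \<xi>_measurable: "\<And>t. random_variable borel (\<xi> t)"
    and \<xi>_law: "\<And>t v. prob {\<omega> \<in> space M. \<xi> t \<omega> = v} = (\<Sum>j | j \<in> {1..S t} \<and> r t j = v. p t j)"
    and p_pos: "\<And>t j. j \<in> {1..S t} \<Longrightarrow> p t j > 0"
    and p_sum: "\<And>t. (\<Sum>j=1..S t. p t j) = 1"
    and \<alpha>: "0 < \<alpha>" "\<alpha> < 1"
    and lam1: "lam1 > 0"
    and lam2: "lam2 > 0"
    and c: "\<And>i. c $ i \<ge> 0"
    and \<gamma>_pos: "0 < \<gamma>"
    and \<gamma>_less: "\<gamma> < Min (range (\<lambda>t::'t. \<alpha> -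
      Max ((\<lambda>J. \<Sum>j\<in>J. p t j) ` {J. J \<subseteq> {1..S t} \<and> (\<Sum>j\<in>J. p t j) < \<alpha>})))"
begin

definition \<mu> :: "'t \<Rightarrow> real^'n" where
  "\<mu> t = (\<Sum>j=1..S t. p t j *\<^sub>R r t j)"

definition loss :: "'t \<Rightarrow> nat \<Rightarrow> real^'n \<Rightarrow> real" where
  "loss t j z = - (r t j \<bullet> z)"

definition f :: "(real^'n, 't) vec \<Rightarrow> real" where
  "f x =
     - (\<Sum>t\<in>UNIV. \<mu> t \<bullet> x $ t)
     + lam1 * ((\<Sum>i\<in>UNIV. c $ i * \<bar>x $ Min UNIV $ i - w_prev $ i\<bar>)
             + (\<Sum>t\<in>UNIV - {Min UNIV}. \<Sum>i\<in>UNIV. c $ i * \<bar>x $ t $ i - x $ Max {s. s < t} $ i\<bar>))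
     + lam2 * (\<Sum>t\<in>UNIV. (norm (x $ t))\<^sup>2)"

definition R :: "(real^'n, 't) vec \<Rightarrow> real" where
  "R x = (\<Sum>t\<in>UNIV. max (value_at_risk \<alpha> M (\<lambda>\<omega>. - (\<xi> t \<omega> \<bullet> x $ t)) - \<tau>) 0)"

definition \<Phi> :: "real \<Rightarrow> (real^'n, 't) vec \<Rightarrow> real" where
  "\<Phi> \<rho> x = f x + \<rho> * R x"

definition cvar_objective :: "real \<Rightarrow> 't \<Rightarrow> real^'n \<Rightarrow> real \<Rightarrow> real" where
  "cvar_objective \<beta> t z u = u + 1 / (1 - \<beta>) * (\<Sum>j=1..S t. p t j * max (loss t j z - u) 0)"

text \<open>For \<open>0 < \<beta> < 1\<close> the infimum is attained, hence a minimum.\<close>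

definition \<psi> :: "real \<Rightarrow> 't \<Rightarrow> real^'n \<Rightarrow> real" where
  "\<psi> \<beta> t z = (INF u. cvar_objective \<beta> t z u)"

definition A :: real where "A = (1 - \<alpha> + \<gamma>) / \<gamma>"

definition B :: real where "B = (1 - \<alpha>) / \<gamma>"

definition G :: "real \<Rightarrow> (real^'n, 't) vec \<Rightarrow> real" where
  "G \<rho> x = f x + \<rho> * (\<Sum>t\<in>UNIV. max (A * \<psi> (\<alpha> - \<gamma>) t (x $ t) - \<tau>) (B * \<psi> \<alpha> t (x $ t)))"

definition H :: "real \<Rightarrow> (real^'n, 't) vec \<Rightarrow> real" where
  "H \<rho> x = \<rho> * B * (\<Sum>t\<in>UNIV. \<psi> \<alpha> t (x $ t))"

definition G_hat :: "real \<Rightarrow> real \<Rightarrow> (real^'n, 't) vec \<Rightarrow> real" where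
  "G_hat \<rho> \<nu> x = G \<rho> x + \<nu> / 2 * (norm x)\<^sup>2"

definition is_cvar_subgradient :: "'t \<Rightarrow> real^'n \<Rightarrow> real^'n \<Rightarrow> bool" where
  "is_cvar_subgradient t z g \<longleftrightarrow>
     (\<exists>u q. is_arg_min (cvar_objective \<alpha> t z) (\<lambda>_. True) u \<and>
        (\<forall>j\<in>{1..S t}.
           (loss t j z > u \<longrightarrow> q j = 1) \<and>
           (loss t j z = u \<longrightarrow> q j \<in> {0..1}) \<and>
           (loss t j z < u \<longrightarrow> q j = 0)) \<and>
        (\<Sum>j=1..S t. p t j * q j) = 1 - \<alpha> \<and>
        g = - (1 / (1 - \<alpha>)) *\<^sub>R (\<Sum>j=1..S t. (p t j * q j) *\<^sub>R r t j))"

definition extrapolated_point :: "real \<Rightarrow> real \<Rightarrow> (real^'n, 't) vec \<Rightarrow> (real^'n, 't) vec \<Rightarrow> (real^'n, 't) vec" where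
  "extrapolated_point \<rho> \<theta> x_old x =
     (let w = closest_point feasible (x + \<theta> *\<^sub>R (x - x_old))
      in if \<Phi> \<rho> w > \<Phi> \<rho> x then x else w)"

definition max_step :: "(real^'n, 't) vec \<Rightarrow> (real^'n, 't) vec \<Rightarrow> real" where
  "max_step w d = (GREATEST l. l \<ge> 1 \<and> w + l *\<^sub>R d \<in> feasible)"

definition line_search ::
    "real \<Rightarrow> real \<Rightarrow> real \<Rightarrow> real \<Rightarrow> (real^'n, 't) vec \<Rightarrow> (real^'n, 't) vec \<Rightarrow> real" where
  "line_search \<rho> \<sigma> \<eta> lam_bar w y =
     (let d = y - w in
      while
        (\<lambda>l. l > 1 \<and> \<Phi> \<rho> (w + l *\<^sub>R d) > min (\<Phi> \<rho> y) (\<Phi> \<rho> w - \<sigma> * l\<^sup>2 * (norm d)\<^sup>2))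
        (\<lambda>l. max 1 (\<eta> * l))
        (min lam_bar (max_step w d)))"

text \<open>
  \<open>iBDCA_step \<dots> x_old x x_new\<close>: started from the current iterate \<open>x\<close> and the previous one
  \<open>x_old\<close>, an iteration does not return and may produce \<open>x_new\<close>. It is a relation because the
  choice of the subgradients is free.
\<close>

definition iBDCA_step ::
    "real \<Rightarrow> real \<Rightarrow> real \<Rightarrow> real \<Rightarrow> real \<Rightarrow> real \<Rightarrow> real \<Rightarrow>
     (real^'n, 't) vec \<Rightarrow> (real^'n, 't) vec \<Rightarrow> (real^'n, 't) vec \<Rightarrow> bool" where
  "iBDCA_step \<rho> \<theta> \<nu> \<sigma> \<eta> lam_bar \<epsilon>_tol x_old x x_new \<longleftrightarrow>
     (\<exists>w g s u y d.
        w = extrapolated_point \<rho> \<theta> x_old x \<and>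
        (\<forall>t. is_cvar_subgradient t (w $ t) (g $ t)) \<and>
        s = (\<rho> * B) *\<^sub>R g \<and>
        u = s + \<nu> *\<^sub>R w \<and>
        is_arg_min (\<lambda>z. G_hat \<rho> \<nu> z - u \<bullet> z) (\<lambda>z. z \<in> feasible) y \<and>
        d = y - w \<and>
        \<not> norm d = 0 \<and>
        \<not> (\<epsilon>_tol > 0 \<and> norm d \<le> \<epsilon>_tol * max 1 (norm w)) \<and>
        x_new = w + line_search \<rho> \<sigma> \<eta> lam_bar w y *\<^sub>R d)"

text \<open>
  At \<open>k = 0\<close> truncated subtraction gives \<open>x (k - 1) = x 0\<close>, which is the initialisation
  $x^{-1} = x^0$.
\<close>

definition iBDCA_infinite_run ::
    "real \<Rightarrow> real \<Rightarrow> real \<Rightarrow> real \<Rightarrow> real \<Rightarrow> real \<Rightarrow> real \<Rightarrow> (nat \<Rightarrow> (real^'n, 't) vec) \<Rightarrow> bool" where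
  "iBDCA_infinite_run \<rho> \<theta> \<nu> \<sigma> \<eta> lam_bar \<epsilon>_tol x \<longleftrightarrow>
     x 0 \<in> feasible \<and>
     (\<forall>k. iBDCA_step \<rho> \<theta> \<nu> \<sigma> \<eta> lam_bar \<epsilon>_tol (x (k - 1)) (x k) (x (Suc k)))"

end

end

theory Submission
  imports Defs
begin

text \<open>
  Writing the value at risk as a difference of two CVaRs, \<open>\<Phi> = G - H\<close>: at both levels
  \<open>\<alpha>\<close> and \<open>\<alpha> - \<gamma>\<close> the value at risk itself minimises the CVaR objective, since no scenario probability lies in \<open>(\<alpha> - \<gamma>, \<alpha>)\<close>.
  Strong convexity of the subproblem makes \<open>\<Phi>\<close> decrease by at least \<open>\<sigma> * (norm d)\<^sup>2\<close> in every
  iteration, also after the line search, and \<open>\<Phi>\<close> is bounded below on the compact feasible set, so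
  the directions \<open>d\<close> tend to zero. If \<open>x\<close> converges along a subsequence, then so do \<open>w\<close> and \<open>y\<close> of the
  preceding iterations, to the same limit, because step lengths are bounded. The subgradients of
  \<open>H\<close> are bounded, and passing to the limit in the optimality condition of the subproblem shows
  that the limit minimises a linearisation of the DC objective, which is criticality by the sum rule.
\<close>

section \<open>Convex analysis\<close>

lemma convex_on_sum_fun:
  fixes F :: "'i \<Rightarrow> 'a::real_vector \<Rightarrow> real"
  assumes "convex C" "\<And>i. i \<in> I \<Longrightarrow> convex_on C (F i)"
  shows "convex_on C (\<lambda>x. \<Sum>i\<in>I. F i x)"
  using assms(2)
proof (induction I rule: infinite_finite_induct)
  case (insert i I)
  then show ?case by (auto intro!: convex_on_add)
qed (simp_all add: convex_on_def assms(1))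

lemma convex_on_max:
  fixes F G :: "'a::real_vector \<Rightarrow> real"
  assumes F: "convex_on C F" and G: "convex_on C G"
  shows "convex_on C (\<lambda>x. max (F x) (G x))"
proof (rule convex_onI)
  fix t :: real and x y
  assume t: "0 < t" "t < 1" and xy: "x \<in> C" "y \<in> C"
  let ?z = "(1 - t) *\<^sub>R x + t *\<^sub>R y"
  have "F ?z \<le> (1 - t) * F x + t * F y" "G ?z \<le> (1 - t) * G x + t * G y"
    using convex_onD[OF F] convex_onD[OF G] t xy by auto
  moreover have "(1 - t) * F x \<le> (1 - t) * max (F x) (G x)" "t * F y \<le> t * max (F y) (G y)"
      "(1 - t) * G x \<le> (1 - t) * max (F x) (G x)" "t * G y \<le> t * max (F y) (G y)"
    using t by (auto intro!: mult_left_mono)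
  ultimately show "max (F ?z) (G ?z) \<le> (1 - t) * max (F x) (G x) + t * max (F y) (G y)"
    by linarith
qed (use F in \<open>simp add: convex_on_def\<close>)

lemma convex_on_linear:
  fixes F :: "'a::real_vector \<Rightarrow> real"
  assumes "linear F"
  shows "convex_on UNIV F"
  by (rule convex_onI) (simp_all only: linear_add[OF assms] linear_scale[OF assms] real_scaleR_def order_refl convex_UNIV)

lemma convex_on_abs_linear:
  fixes F :: "'a::real_vector \<Rightarrow> real"
  assumes "linear F"
  shows "convex_on UNIV (\<lambda>x. \<bar>F x + b\<bar>)"
proof (rule convex_onI)
  fix t :: real and x y
  assume t: "0 < t" "t < 1"
  have "F ((1 - t) *\<^sub>R x + t *\<^sub>R y) + b = (1 - t) * (F x + b) + t * (F y + b)"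
    by (simp only: linear_add[OF assms] linear_scale[OF assms]) (simp add: algebra_simps)
  then show "\<bar>F ((1 - t) *\<^sub>R x + t *\<^sub>R y) + b\<bar> \<le> (1 - t) * \<bar>F x + b\<bar> + t * \<bar>F y + b\<bar>"
    using t abs_triangle_ineq[of "(1 - t) * (F x + b)" "t * (F y + b)"] by (simp add: abs_mult)
qed simp

text \<open>An affine minorant touching \<open>F\<close> at the convex combination is averaged over
  the endpoints, where its slope terms cancel. This suits \<open>\<psi>\<close>, which is an infimum
  but has explicit subgradients.\<close>

lemma convex_on_subdifferential:
  assumes "\<And>x. subdifferential F x \<noteq> {}"
  shows "convex_on UNIV F"
proof (rule convex_onI)
  fix t :: real and x y :: 'a
  assume t: "0 < t" "t < 1"
  let ?z = "(1 - t) *\<^sub>R x + t *\<^sub>R y"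
  obtain s where s: "\<And>y. F y \<ge> F ?z + s \<bullet> (y - ?z)"
    using assms[of ?z] by (auto simp: subdifferential_def)
  have "(1 - t) * (F ?z + s \<bullet> (x - ?z)) \<le> (1 - t) * F x" "t * (F ?z + s \<bullet> (y - ?z)) \<le> t * F y"
    using t s by (auto intro!: mult_left_mono)
  moreover have "(1 - t) * (F ?z + s \<bullet> (x - ?z)) + t * (F ?z + s \<bullet> (y - ?z)) = F ?z"
    by (simp add: algebra_simps inner_simps)
  ultimately show "F ?z \<le> (1 - t) * F x + t * F y" by linarith
qed simp

lemma convex_norm_square: "convex_on UNIV (\<lambda>x :: 'a::real_inner. (norm x)\<^sup>2)"
proof (rule convex_on_subdifferential)
  fix x :: 'a
  have "(norm x)\<^sup>2 + (2 *\<^sub>R x) \<bullet> (y - x) \<le> (norm y)\<^sup>2" for y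
    using inner_ge_zero[of "y - x"]
    by (simp add: power2_norm_eq_inner inner_simps inner_commute del: inner_ge_zero)
  then show "subdifferential (\<lambda>x. (norm x)\<^sup>2) x \<noteq> {}" unfolding subdifferential_def by blast
qed

section \<open>Subgradients and constrained minimisers\<close>

lemma subdifferential_limit:
  assumes "continuous_on UNIV F" "w \<longlonglongrightarrow> x" "s \<longlonglongrightarrow> v"
    and "\<And>n. s n \<in> subdifferential F (w n)"
  shows "v \<in> subdifferential F x"
proof -
  have "F x + v \<bullet> (y - x) \<le> F y" for y
  proof (rule LIMSEQ_le_const2)
    have "(\<lambda>n. F (w n)) \<longlonglongrightarrow> F x"
      using assms(1,2) by (simp add: continuous_on_tendsto_compose)
    then show "(\<lambda>n. F (w n) + s n \<bullet> (y - w n)) \<longlonglongrightarrow> F x + v \<bullet> (y - x)"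
      by (intro tendsto_intros assms)
    show "\<exists>N. \<forall>n\<ge>N. F (w n) + s n \<bullet> (y - w n) \<le> F y"
      using assms(4) by (auto simp: subdifferential_def)
  qed
  then show ?thesis by (simp add: subdifferential_def)
qed

text \<open>On the segment from \<open>y\<close> to \<open>w\<close> the squared norm lies below its
  linear interpolation by \<open>t * (1 - t) * (norm (w - y))\<^sup>2\<close>. Minimality of
  \<open>y\<close>, divided by \<open>t\<close>, keeps this gap as \<open>t\<close> tends to
  0.\<close>

lemma minimizer_quadratic_growth:
  fixes F :: "'a::real_inner \<Rightarrow> real"
  assumes C: "convex C" and F: "convex_on C F" and y: "y \<in> C" and w: "w \<in> C"
    and min: "\<And>z. z \<in> C \<Longrightarrow> F y + c * (norm y)\<^sup>2 \<le> F z + c * (norm z)\<^sup>2"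
  shows "F y + c * (norm y)\<^sup>2 + c * (norm (w - y))\<^sup>2 \<le> F w + c * (norm w)\<^sup>2"
proof -
  let ?Q = "\<lambda>z. F z + c * (norm z)\<^sup>2" and ?D = "(norm (w - y))\<^sup>2"
  have bound: "?Q y + c * (1 - t) * ?D \<le> ?Q w" if t: "0 < t" "t < 1" for t
  proof -
    let ?z = "(1 - t) *\<^sub>R y + t *\<^sub>R w"
    have "?z \<in> C" using C y w t by (simp add: convex_alt)
    then have "?Q y \<le> ?Q ?z" by (rule min)
    also have "(norm ?z)\<^sup>2 = (1 - t) * (norm y)\<^sup>2 + t * (norm w)\<^sup>2 - t * (1 - t) * ?D"
      unfolding power2_norm_eq_inner
      by (simp add: inner_simps inner_commute algebra_simps power2_eq_square)
    also have "F ?z \<le> (1 - t) * F y + t * F w"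
      using convex_onD[OF F] t y w by auto
    finally have "t * (?Q y + c * (1 - t) * ?D) \<le> t * ?Q w"
      by (simp add: algebra_simps)
    then show ?thesis using t by simp
  qed
  have "((\<lambda>t. ?Q y + c * (1 - t) * ?D) \<longlongrightarrow> ?Q y + c * (1 - 0) * ?D) (at_right 0)"
    by (intro tendsto_intros)
  moreover have "eventually (\<lambda>t. ?Q y + c * (1 - t) * ?D \<le> ?Q w) (at_right 0)"
    using bound eventually_at_right_real[of 0 1] by (auto elim!: eventually_mono)
  ultimately have "?Q y + c * (1 - 0) * ?D \<le> ?Q w"
    by (intro tendsto_upperbound) auto
  then show ?thesis by simp
qed

text \<open>
  The sum rule of Moreau and Rockafellar, for a finite convex function and an indicator function:
  separate the strict epigraph of the tilted function from \<open>C \<times> {..min}\<close>.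
\<close>

lemma constrained_minimizer_subdifferential:
  fixes F :: "'a::euclidean_space \<Rightarrow> real"
  assumes C: "convex C" and F: "convex_on UNIV F" and x: "x \<in> C"
    and min: "\<And>z. z \<in> C \<Longrightarrow> F x - s \<bullet> x \<le> F z - s \<bullet> z"
  shows "s \<in> {a + b | a b. a \<in> subdifferential F x \<and> b \<in> normal_cone C x}"
proof -
  \<comment> \<open>Tilted by \<open>s\<close> and shifted so that \<open>g x = 0\<close>;
    minimality of \<open>x\<close> says exactly that \<open>g\<close> is nonnegative on
    \<open>C\<close>.\<close>
  define g where "g z = F z - F x - s \<bullet> (z - x)" for z
  have g: "convex_on UNIV g"
  proof (rule convex_onI)
    fix t :: real and u v :: 'a
    assume t: "0 < t" "t < 1"
    show "g ((1 - t) *\<^sub>R u + t *\<^sub>R v) \<le> (1 - t) * g u + t * g v"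
      using convex_onD[OF F, of t u v] t by (simp add: g_def inner_simps algebra_simps)
  qed simp
  let ?D = "{(z, t). g z < t}" and ?E = "C \<times> {..0::real}"
  have "convex ?D"
  proof (rule convexI)
    fix u v :: "'a \<times> real" and a b :: real
    assume uv: "u \<in> ?D" "v \<in> ?D" and ab: "0 \<le> a" "0 \<le> b" "a + b = 1"
    have "g (a *\<^sub>R fst u + b *\<^sub>R fst v) \<le> a * g (fst u) + b * g (fst v)"
      using g ab by (auto simp: convex_on_def)
    also have "\<dots> < a * snd u + b * snd v"
    proof (cases "a = 0")
      case True
      then show ?thesis using uv ab by auto
    next
      case False
      then have "a * g (fst u) < a * snd u" "b * g (fst v) \<le> b * snd v"
        using uv ab by (auto intro!: mult_left_mono simp: case_prod_beta)
      then show ?thesis by linarith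
    qed
    finally show "a *\<^sub>R u + b *\<^sub>R v \<in> ?D" by (simp add: case_prod_beta)
  qed
  moreover have "convex ?E" using C by (intro convex_Times) auto
  moreover have "(x, 1) \<in> ?D" "(x, 0) \<in> ?E" using x by (auto simp: g_def)
  moreover have "?D \<inter> ?E = {}"
  proof -
    have "g z \<ge> 0" if "z \<in> C" for z
      using min[OF that] by (simp add: g_def inner_simps)
    then show ?thesis by force
  qed
  ultimately obtain n :: "'a \<times> real" and \<beta> where n: "n \<noteq> 0"
    and E: "\<And>q. q \<in> ?E \<Longrightarrow> n \<bullet> q \<le> \<beta>" and D: "\<And>q. q \<in> ?D \<Longrightarrow> n \<bullet> q \<ge> \<beta>"
    using separating_hyperplane_sets[of ?E ?D] by blast
  obtain a b where ab: "n = (a, b)" by fastforce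
  have D': "a \<bullet> z + b * t \<ge> \<beta>" if "g z < t" for z t
    using D[of "(z, t)"] that ab by simp
  have E': "a \<bullet> z \<le> \<beta>" if "z \<in> C" for z
    using E[of "(z, 0)"] that ab by simp
  have gx: "g x = 0" by (simp add: g_def)
  have ax: "a \<bullet> x \<le> \<beta>" using E' x .
  have "b \<ge> 0"
    using E[of "(x, -1)"] D'[of x 1] x gx ab by simp
  \<comment> \<open>Otherwise the hyperplane is vertical. As \<open>g\<close> is finite everywhere,
    the point \<open>x - a\<close> may be tested; this forces \<open>a = 0\<close>, contradicting
    \<open>n \<noteq> 0\<close>.\<close>
  moreover have "b \<noteq> 0"
  proof
    assume b: "b = 0"
    have "a \<bullet> (x - a) \<ge> \<beta>" using D'[of "x - a" "g (x - a) + 1"] b by simp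
    then have "a \<bullet> a \<le> 0" using ax by (simp add: inner_simps)
    then have "a = 0" using inner_ge_zero[of a] by (metis inner_eq_zero_iff order_antisym)
    then show False using n ab b by (simp add: zero_prod_def)
  qed
  ultimately have b: "b > 0" by simp
  have D0: "\<beta> \<le> a \<bullet> z + b * g z" for z
  proof (rule field_le_epsilon)
    fix e :: real
    assume "e > 0"
    then show "\<beta> \<le> a \<bullet> z + b * g z + e"
      using D'[of z "g z + e / b"] b by (simp add: algebra_simps)
  qed
  have \<beta>: "\<beta> = a \<bullet> x" using D0[of x] ax gx by simp
  \<comment> \<open>Dividing by \<open>b\<close> makes \<open>?v\<close> normal to \<open>C\<close>
    and \<open>- ?v\<close> a subgradient of \<open>g\<close> at \<open>x\<close>; undoing the tilt
    turns the latter into \<open>s - ?v\<close> for \<open>F\<close>.\<close>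
  let ?v = "a /\<^sub>R b"
  have "?v \<in> normal_cone C x"
    using E' b \<beta> by (auto simp: normal_cone_def inner_simps divide_simps)
  moreover have "s - ?v \<in> subdifferential F x"
  proof -
    have "F x + (s - ?v) \<bullet> (z - x) \<le> F z" for z
    proof -
      have "0 \<le> (a \<bullet> (z - x) + b * g z) / b"
        using D0[of z] b \<beta> by (simp add: inner_simps)
      also have "\<dots> = ?v \<bullet> (z - x) + g z"
        using b by (simp add: field_simps inner_simps)
      finally show ?thesis by (simp add: g_def inner_simps algebra_simps)
    qed
    then show ?thesis by (simp add: subdifferential_def)
  qed
  ultimately show ?thesis by (intro CollectI exI[of _ "s - ?v"] exI[of _ ?v]) simp
qed

section \<open>Backtracking loops and decreasing sequences\<close>

lemma while_backtracking:
  fixes \<eta> l :: real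
  assumes \<eta>: "0 < \<eta>" "\<eta> < 1" and b: "\<And>l. b l \<Longrightarrow> l > 1" and l: "1 \<le> l"
  defines "res \<equiv> while b (\<lambda>l. max 1 (\<eta> * l)) l"
  shows "1 \<le> res" "res \<le> l" "\<not> b res"
proof -
  \<comment> \<open>\<open>n\<close> bounds the number of remaining passes: each one multiplies by
    \<open>\<eta>\<close> or clamps at 1, and at 1 the guard fails.\<close>
  have *: "\<eta> ^ n * l \<le> 1 \<Longrightarrow> 1 \<le> l \<Longrightarrow>
      (let res = while b (\<lambda>l. max 1 (\<eta> * l)) l in 1 \<le> res \<and> res \<le> l \<and> \<not> b res)" for n l
  proof (induction n arbitrary: l)
    case 0
    then have "\<not> b l" using b[of l] by auto
    then show ?case using 0 by (subst while_unfold) simp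
  next
    case (Suc n)
    show ?case
    proof (cases "b l")
      case False
      then show ?thesis using Suc.prems by (subst while_unfold) simp
    next
      case True
      let ?l = "max 1 (\<eta> * l)"
      have "\<eta> ^ n * ?l \<le> 1"
        using Suc.prems \<eta> power_le_one[of \<eta> n] by (auto simp: max_def ac_simps)
      then have "let res = while b (\<lambda>l. max 1 (\<eta> * l)) ?l in 1 \<le> res \<and> res \<le> ?l \<and> \<not> b res"
        by (intro Suc.IH) auto
      moreover have "?l \<le> l" using Suc.prems \<eta> by (simp add: mult_le_cancel_right1)
      ultimately show ?thesis using True
        by (subst while_unfold) (simp only: Let_def if_True, metis order_trans)
    qed
  qed
  obtain n where "\<eta> ^ n < 1 / l" using real_arch_pow_inv[of "1 / l" \<eta>] \<eta> l by auto
  then have "\<eta> ^ n * l \<le> 1" using l by (simp add: field_simps)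
  from *[OF this l] show "1 \<le> res" "res \<le> l" "\<not> b res" by (auto simp: res_def Let_def)
qed

text \<open>\<open>a\<close> converges, being decreasing and bounded below, and \<open>e\<close> is
  squeezed between 0 and the differences of consecutive terms.\<close>

lemma decrease_tendsto_zero:
  fixes a e :: "nat \<Rightarrow> real"
  assumes dec: "\<And>k. a (Suc k) \<le> a k - e k" and e: "\<And>k. 0 \<le> e k" and lb: "\<And>k. m \<le> a k"
  shows "e \<longlonglongrightarrow> 0"
proof -
  have "decseq a" by (rule decseq_SucI) (use dec e in \<open>smt (verit)\<close>)
  then obtain L where L: "a \<longlonglongrightarrow> L" using decseq_convergent[of a m] lb by blast
  have "(\<lambda>k. a k - a (Suc k)) \<longlonglongrightarrow> L - L"
    by (intro tendsto_diff L LIMSEQ_Suc)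
  then have lim: "(\<lambda>k. a k - a (Suc k)) \<longlonglongrightarrow> 0" by simp
  have "e k \<le> a k - a (Suc k)" for k using dec[of k] by simp
  then show ?thesis
    by (intro tendsto_sandwich[OF _ _ tendsto_const lim] always_eventually) (use e in auto)
qed

section \<open>The value at risk as a difference of convex functions\<close>

lemma compact_feasible: "compact (feasible :: (real^'n^'t) set)"
proof -
  have "feasible = (\<Inter>t. {x :: real^'n^'t. (\<Sum>i\<in>UNIV. x $ t $ i) = 1} \<inter> (\<Inter>i. {x. 0 \<le> x $ t $ i}))"
    by (auto simp: feasible_def weight_simplex_def)
  also have "closed \<dots>"
    by (intro closed_INT ballI closed_Int closed_Collect_eq closed_Collect_le continuous_intros)
  finally have "closed (feasible :: (real^'n^'t) set)" .
  moreover have "bounded (feasible :: (real^'n^'t) set)"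
  proof (rule boundedI)
    fix x :: "real^'n^'t"
    assume x: "x \<in> feasible"
    have "norm x \<le> (\<Sum>t\<in>UNIV. norm (x $ t))"
      by (simp add: norm_vec_def L2_set_le_sum)
    also have "\<dots> \<le> (\<Sum>t\<in>UNIV. \<Sum>i\<in>UNIV. \<bar>x $ t $ i\<bar>)"
      by (intro sum_mono norm_le_l1_cart)
    also have "\<dots> = (\<Sum>t\<in>(UNIV :: 't set). 1)"
      using x by (intro sum.cong) (simp_all add: feasible_def weight_simplex_def)
    finally show "norm x \<le> CARD('t)" by simp
  qed
  ultimately show ?thesis by (simp add: compact_eq_bounded_closed)
qed

lemma convex_feasible: "convex (feasible :: (real^'n^'t) set)"
proof (rule convexI)
  fix x y :: "real^'n^'t" and u v :: real
  assume "x \<in> feasible" "y \<in> feasible" and uv: "0 \<le> u" "0 \<le> v" "u + v = 1"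
  then show "u *\<^sub>R x + v *\<^sub>R y \<in> feasible"
    by (auto simp: feasible_def weight_simplex_def sum.distrib sum_distrib_left[symmetric])
qed

text \<open>Turns the regulariser of \<open>f\<close> into one squared norm, a source of strong
  convexity for the subproblem.\<close>

lemma sum_norm_blocks: "(\<Sum>t\<in>UNIV. (norm (x $ t))\<^sup>2) = (norm (x :: real^'n^'t))\<^sup>2"
  by (simp add: power2_norm_eq_inner inner_vec_def)

section \<open>CVaR through tail weights\<close>

context portfolio
begin

text \<open>
  \<open>q\<close> splits the probability mass at the level \<open>u\<close> so that exactly the mass \<open>1 - \<beta>\<close> lies in the
  upper tail; such weights exist precisely when \<open>u\<close> is a \<open>\<beta>\<close>-quantile of the loss.
\<close>

definition tail_weights :: "real \<Rightarrow> 't \<Rightarrow> real^'n \<Rightarrow> real \<Rightarrow> (nat \<Rightarrow> real) \<Rightarrow> bool" where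
  "tail_weights \<beta> t z u q \<longleftrightarrow>
     (\<forall>j\<in>{1..S t}.
        (loss t j z > u \<longrightarrow> q j = 1) \<and>
        (loss t j z = u \<longrightarrow> q j \<in> {0..1}) \<and>
        (loss t j z < u \<longrightarrow> q j = 0)) \<and>
     (\<Sum>j=1..S t. p t j * q j) = 1 - \<beta>"

text \<open>The subgradient formula of the algorithm with the level left free, since it is needed at
  \<open>\<alpha> - \<gamma>\<close> as well as at \<open>\<alpha>\<close>.\<close>

definition tail_gradient :: "real \<Rightarrow> 't \<Rightarrow> (nat \<Rightarrow> real) \<Rightarrow> real^'n" where
  "tail_gradient \<beta> t q = - (1 / (1 - \<beta>)) *\<^sub>R (\<Sum>j=1..S t. (p t j * q j) *\<^sub>R r t j)"

lemma p_nonneg: "j \<in> {1..S t} \<Longrightarrow> 0 \<le> p t j"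
  using p_pos[of j t] by simp

lemma tail_weights_bounds: "tail_weights \<beta> t z u q \<Longrightarrow> j \<in> {1..S t} \<Longrightarrow> 0 \<le> q j \<and> q j \<le> 1"
  unfolding tail_weights_def by (cases "loss t j z" u rule: linorder_cases) auto

text \<open>With the same weights \<open>q\<close>, this is at once optimality of \<open>u\<close> and a subgradient inequality.\<close>

lemma cvar_objective_lower_bound:
  assumes \<beta>: "\<beta> < 1" and q: "tail_weights \<beta> t z u q"
  shows "cvar_objective \<beta> t z u + tail_gradient \<beta> t q \<bullet> (z' - z) \<le> cvar_objective \<beta> t z' u'"
proof -
  \<comment> \<open>The weight \<open>q j\<close> is a slope of the positive part at
    \<open>loss t j z - u\<close>, so this is a subgradient inequality for each single
    scenario.\<close>
  have "max (loss t j z - u) 0 + q j * (loss t j z' - loss t j z) - q j * (u' - u)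
      \<le> max (loss t j z' - u') 0" if j: "j \<in> {1..S t}" for j
  proof -
    have "max (loss t j z - u) 0 = q j * (loss t j z - u)"
      using q j by (cases "loss t j z" u rule: linorder_cases) (auto simp: tail_weights_def)
    then have "max (loss t j z - u) 0 + q j * (loss t j z' - loss t j z) - q j * (u' - u)
        = q j * (loss t j z' - u')"
      by (simp add: algebra_simps)
    also have "\<dots> \<le> q j * max (loss t j z' - u') 0"
      using tail_weights_bounds[OF q j] by (intro mult_left_mono) auto
    also have "\<dots> \<le> 1 * max (loss t j z' - u') 0"
      using tail_weights_bounds[OF q j] by (intro mult_right_mono) auto
    finally show ?thesis by simp
  qed
  then have "(\<Sum>j=1..S t. p t j * (max (loss t j z - u) 0 + q j * (loss t j z' - loss t j z) - q j * (u' - u)))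
      \<le> (\<Sum>j=1..S t. p t j * max (loss t j z' - u') 0)"
    by (intro sum_mono mult_left_mono p_nonneg) auto
  also have "(\<Sum>j=1..S t. p t j * (max (loss t j z - u) 0 + q j * (loss t j z' - loss t j z) - q j * (u' - u)))
      = (\<Sum>j=1..S t. p t j * max (loss t j z - u) 0)
        + (\<Sum>j=1..S t. p t j * q j * (loss t j z' - loss t j z)) - (\<Sum>j=1..S t. p t j * q j) * (u' - u)"
    by (simp add: algebra_simps sum.distrib sum_subtractf sum_distrib_left)
  \<comment> \<open>With the prefactor \<open>1 / (1 - \<beta>)\<close>, this mass gives
    \<open>u' - u\<close> the coefficient -1, which cancels the linear term of the
    objective.\<close>
  also have "(\<Sum>j=1..S t. p t j * q j) = 1 - \<beta>" using q by (simp add: tail_weights_def)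
  also have "(\<Sum>j=1..S t. p t j * q j * (loss t j z' - loss t j z))
      = (1 - \<beta>) * (tail_gradient \<beta> t q \<bullet> (z' - z))"
  proof -
    have "loss t j z' - loss t j z = - (r t j \<bullet> (z' - z))" for j
      by (simp add: loss_def inner_simps)
    then show ?thesis
      using \<beta> by (simp add: tail_gradient_def inner_sum_left sum_negf)
  qed
  finally have "(\<Sum>j=1..S t. p t j * max (loss t j z - u) 0)
      + (1 - \<beta>) * (tail_gradient \<beta> t q \<bullet> (z' - z)) - (1 - \<beta>) * (u' - u)
      \<le> (\<Sum>j=1..S t. p t j * max (loss t j z' - u') 0)" .
  then have "1 / (1 - \<beta>) * ((\<Sum>j=1..S t. p t j * max (loss t j z - u) 0)
      + (1 - \<beta>) * (tail_gradient \<beta> t q \<bullet> (z' - z)) - (1 - \<beta>) * (u' - u))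
      \<le> 1 / (1 - \<beta>) * (\<Sum>j=1..S t. p t j * max (loss t j z' - u') 0)"
    using \<beta> by (intro mult_left_mono) auto
  moreover have "1 / (1 - \<beta>) * (a + (1 - \<beta>) * b - (1 - \<beta>) * d) = 1 / (1 - \<beta>) * a + b - d" for a b d
    using \<beta> by (simp add: field_simps)
  ultimately show ?thesis by (simp add: cvar_objective_def)
qed

lemma \<psi>_eq_cvar_objective:
  assumes "\<beta> < 1" "tail_weights \<beta> t z u q"
  shows "\<psi> \<beta> t z = cvar_objective \<beta> t z u"
  unfolding \<psi>_def using cvar_objective_lower_bound[OF assms, of z]
  by (intro cInf_eq_minimum) auto

lemma tail_prob_split:
  "(\<Sum>j | j \<in> {1..S t} \<and> P j. p t j) + (\<Sum>j | j \<in> {1..S t} \<and> \<not> P j. p t j) = 1"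
proof -
  have "(\<Sum>j | j \<in> {1..S t} \<and> P j. p t j) + (\<Sum>j | j \<in> {1..S t} \<and> \<not> P j. p t j)
     = (\<Sum>j\<in>{j. j \<in> {1..S t} \<and> P j} \<union> {j. j \<in> {1..S t} \<and> \<not> P j}. p t j)"
    by (intro sum.union_disjoint[symmetric]) auto
  also have "{j. j \<in> {1..S t} \<and> P j} \<union> {j. j \<in> {1..S t} \<and> \<not> P j} = {1..S t}" by auto
  finally show ?thesis by (simp only: p_sum)
qed

text \<open>The required tail mass \<open>1 - \<beta>\<close> lies between the probability of a loss
  above \<open>u\<close> and that of a loss at least \<open>u\<close>, so a fraction of the mass at
  \<open>u\<close> makes up the difference.\<close>

lemma tail_weights_exist:
  assumes lt: "(\<Sum>j | j \<in> {1..S t} \<and> loss t j z < u. p t j) \<le> \<beta>"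
    and le: "\<beta> \<le> (\<Sum>j | j \<in> {1..S t} \<and> loss t j z \<le> u. p t j)"
  obtains q where "tail_weights \<beta> t z u q"
proof -
  define Plt where "Plt = (\<Sum>j | j \<in> {1..S t} \<and> loss t j z < u. p t j)"
  define Peq where "Peq = (\<Sum>j | j \<in> {1..S t} \<and> loss t j z = u. p t j)"
  define Pgt where "Pgt = (\<Sum>j | j \<in> {1..S t} \<and> loss t j z > u. p t j)"
  have "Peq \<ge> 0" unfolding Peq_def by (intro sum_nonneg p_nonneg) auto
  have Ple: "(\<Sum>j | j \<in> {1..S t} \<and> loss t j z \<le> u. p t j) = Plt + Peq"
    unfolding Plt_def Peq_def
    by (subst sum.union_disjoint[symmetric]) (auto intro!: sum.cong)
  have total: "Plt + Peq + Pgt = 1"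
    using tail_prob_split[of t "\<lambda>j. loss t j z \<le> u"] Ple by (simp add: Pgt_def not_le)
  \<comment> \<open>The fraction of the mass at \<open>u\<close> counted as tail. Without mass
    there, the hypotheses force \<open>Pgt = 1 - \<beta>\<close>, and the default 0 is
    right.\<close>
  define h where "h = (if Peq = 0 then 0 else (1 - \<beta> - Pgt) / Peq)"
  have h: "h \<in> {0..1}" "h * Peq = 1 - \<beta> - Pgt"
    using lt le total \<open>Peq \<ge> 0\<close> unfolding Ple Plt_def[symmetric] h_def by (auto simp: field_simps)
  define q where "q j = (if loss t j z > u then 1 else if loss t j z = u then h else 0)" for j
  have "(\<Sum>j=1..S t. p t j * q j)
      = (\<Sum>j=1..S t. (if loss t j z > u then p t j else 0) + (if loss t j z = u then p t j else 0) * h)"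
    by (intro sum.cong) (auto simp: q_def)
  also have "\<dots> = Pgt + Peq * h"
    unfolding Pgt_def Peq_def sum.distrib sum_distrib_right[symmetric]
    by (simp add: sum.inter_filter[symmetric])
  finally have "tail_weights \<beta> t z u q"
    using h by (auto simp: tail_weights_def q_def mult.commute)
  then show thesis by (rule that)
qed

section \<open>The law of the losses and its quantiles\<close>

lemma prob_scenarios:
  assumes P: "Measurable.pred borel P"
  shows "prob {\<omega> \<in> space M. P (\<xi> t \<omega>)} = (\<Sum>j | j \<in> {1..S t} \<and> P (r t j). p t j)"
proof -
  have meas: "{\<omega> \<in> space M. Q (\<xi> t \<omega>)} \<in> events" if Q: "Measurable.pred borel Q" for Q
    using measurable_compose[OF \<xi>_measurable Q] by simp
  \<comment> \<open>Adding up atoms gives only a lower bound; used for the complement too, with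
    total mass 1, it becomes an equality.\<close>
  have lower: "(\<Sum>j | j \<in> {1..S t} \<and> Q (r t j). p t j) \<le> prob {\<omega> \<in> space M. Q (\<xi> t \<omega>)}"
    if Q: "Measurable.pred borel Q" for Q
  proof -
    define W where "W = {v \<in> r t ` {1..S t}. Q v}"
    have W: "finite W" by (simp add: W_def)
    have "(\<Sum>j | j \<in> {1..S t} \<and> Q (r t j). p t j)
        = (\<Sum>v\<in>W. \<Sum>j | j \<in> {j. j \<in> {1..S t} \<and> Q (r t j)} \<and> r t j = v. p t j)"
      by (rule sum.group[symmetric]) (auto simp: W_def)
    also have "\<dots> = (\<Sum>v\<in>W. prob {\<omega> \<in> space M. \<xi> t \<omega> = v})"
      unfolding \<xi>_law by (intro sum.cong) (auto simp: W_def)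
    also have "\<dots> = prob (\<Union>v\<in>W. {\<omega> \<in> space M. \<xi> t \<omega> = v})"
      by (intro finite_measure_finite_Union[symmetric] W) (auto simp: disjoint_family_on_def intro!: meas)
    also have "\<dots> \<le> prob {\<omega> \<in> space M. Q (\<xi> t \<omega>)}"
      using meas[OF Q] by (intro finite_measure_mono) (auto simp: W_def)
    finally show ?thesis .
  qed
  have "prob {\<omega> \<in> space M. \<not> P (\<xi> t \<omega>)} = 1 - prob {\<omega> \<in> space M. P (\<xi> t \<omega>)}"
    using prob_neg[OF meas[OF P]] by simp
  moreover have "Measurable.pred borel (\<lambda>v. \<not> P v)" using P by simp
  ultimately show ?thesis
    using lower[OF P] lower[of "\<lambda>v. \<not> P v"] tail_prob_split[of t "\<lambda>j. P (r t j)"] by linarith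
qed

definition VaR :: "'t \<Rightarrow> real^'n \<Rightarrow> real" where
  "VaR t z = value_at_risk \<alpha> M (\<lambda>\<omega>. - (\<xi> t \<omega> \<bullet> z))"

text \<open>The maximum in \<open>\<gamma>_less\<close> runs over all subset sums below
  \<open>\<alpha>\<close>, this one included. The gap makes the value at risk a quantile at level
  \<open>\<alpha> - \<gamma>\<close> too.\<close>

lemma scenario_prob_gap:
  assumes J: "J \<subseteq> {1..S t}" and less: "(\<Sum>j\<in>J. p t j) < \<alpha>"
  shows "(\<Sum>j\<in>J. p t j) \<le> \<alpha> - \<gamma>"
proof -
  let ?m = "\<lambda>t. Max ((\<lambda>J. \<Sum>j\<in>J. p t j) ` {J. J \<subseteq> {1..S t} \<and> (\<Sum>j\<in>J. p t j) < \<alpha>})"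
  have "finite {J. J \<subseteq> {1..S t} \<and> (\<Sum>j\<in>J. p t j) < \<alpha>}"
    by (rule finite_subset[of _ "Pow {1..S t}"]) auto
  then have "(\<Sum>j\<in>J. p t j) \<le> ?m t" using J less by (intro Max_ge) auto
  moreover have "\<gamma> < \<alpha> - ?m t" using \<gamma>_less by (subst (asm) Min_gr_iff) auto
  ultimately show ?thesis by linarith
qed

text \<open>The distribution function \<open>D\<close> jumps only at scenario losses, so it first
  reaches \<open>\<alpha>\<close> at one of them, \<open>Min V\<close>, and the infimum defining the
  value at risk is attained there.\<close>

lemma VaR_quantile:
  shows "\<alpha> \<le> (\<Sum>j | j \<in> {1..S t} \<and> loss t j z \<le> VaR t z. p t j)"
    and "(\<Sum>j | j \<in> {1..S t} \<and> loss t j z < VaR t z. p t j) \<le> \<alpha> - \<gamma>"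
proof -
  define D where "D u = (\<Sum>j | j \<in> {1..S t} \<and> loss t j z \<le> u. p t j)" for u
  define V where "V = {u \<in> (\<lambda>j. loss t j z) ` {1..S t}. \<alpha> \<le> D u}"
  have "finite V" by (simp add: V_def)
  \<comment> \<open>\<open>P\<close> selects a lower set of losses, so its mass is \<open>D\<close>
    at its largest loss. It is applied to all scenarios, to losses at most \<open>u\<close>, and to
    losses strictly below \<open>Min V\<close>.\<close>
  have attained: "\<exists>v\<in>V. v \<le> u"
    if J: "\<alpha> \<le> (\<Sum>j | j \<in> {1..S t} \<and> P j. p t j)" and u: "\<And>j. j \<in> {1..S t} \<Longrightarrow> P j \<Longrightarrow> loss t j z \<le> u"
      and cut: "\<And>i j. j \<in> {1..S t} \<Longrightarrow> P i \<Longrightarrow> loss t j z \<le> loss t i z \<Longrightarrow> P j" for P u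
  proof -
    let ?J = "{j. j \<in> {1..S t} \<and> P j}"
    have "?J \<noteq> {}" using J \<alpha> by (metis not_le sum.empty)
    define v where "v = Max ((\<lambda>j. loss t j z) ` ?J)"
    have v: "v \<in> (\<lambda>j. loss t j z) ` ?J"
      unfolding v_def using \<open>?J \<noteq> {}\<close> by (intro Max_in) auto
    have max: "loss t j z \<le> v" if "j \<in> ?J" for j
      unfolding v_def using that by (intro Max_ge) auto
    have "D v = (\<Sum>j\<in>?J. p t j)"
      unfolding D_def using v max cut by (intro sum.cong) auto
    then have "v \<in> V" using v J by (auto simp: V_def)
    moreover have "v \<le> u" using v u by auto
    ultimately show ?thesis by blast
  qed
  have "\<alpha> \<le> (\<Sum>j | j \<in> {1..S t} \<and> True. p t j)"
    using \<alpha> p_sum[of t] by (simp only: simp_thms Collect_mem_eq)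
  then have "V \<noteq> {}"
    using attained[of "\<lambda>_. True" "Max ((\<lambda>j. loss t j z) ` {1..S t})"] by auto
  define v where "v = Min V"
  have v: "v \<in> V" unfolding v_def using \<open>V \<noteq> {}\<close> \<open>finite V\<close> by (rule Min_in[rotated])
  have least: "v \<le> u" if "u \<in> V" for u
    unfolding v_def using \<open>finite V\<close> that by (rule Min_le)
  have "{u. \<alpha> \<le> D u} = {v..}"
  proof (intro set_eqI iffI)
    fix u
    assume "u \<in> {u. \<alpha> \<le> D u}"
    then show "u \<in> {v..}"
      using attained[of "\<lambda>j. loss t j z \<le> u" u] least unfolding D_def by fastforce
  next
    fix u
    assume "u \<in> {v..}"
    then have "D v \<le> D u"
      unfolding D_def by (intro sum_mono2 p_nonneg) auto
    then show "u \<in> {u. \<alpha> \<le> D u}" using v by (simp add: V_def)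
  qed
  moreover have "prob {\<omega> \<in> space M. - (\<xi> t \<omega> \<bullet> z) \<le> u} = D u" for u
    unfolding D_def loss_def by (rule prob_scenarios) measurable
  ultimately have VaR: "VaR t z = v" by (simp add: VaR_def value_at_risk_def)
  show "\<alpha> \<le> (\<Sum>j | j \<in> {1..S t} \<and> loss t j z \<le> VaR t z. p t j)"
    using v by (simp add: VaR V_def D_def)
  show "(\<Sum>j | j \<in> {1..S t} \<and> loss t j z < VaR t z. p t j) \<le> \<alpha> - \<gamma>"
  proof (rule scenario_prob_gap)
    show "(\<Sum>j | j \<in> {1..S t} \<and> loss t j z < VaR t z. p t j) < \<alpha>"
    proof (rule ccontr)
      assume neg: "\<not> ?thesis"
      then have "\<alpha> \<le> (\<Sum>j | j \<in> {1..S t} \<and> loss t j z < v. p t j)" by (simp add: VaR)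
      then have ne: "{j. j \<in> {1..S t} \<and> loss t j z < v} \<noteq> {}" using \<alpha> by (metis not_le sum.empty)
      \<comment> \<open>If the losses strictly below \<open>v\<close> already had mass
        \<open>\<alpha>\<close>, some element of \<open>V\<close> would be at most their maximum
        \<open>m\<close>, hence below \<open>Min V\<close>.\<close>
      define m where "m = Max ((\<lambda>j. loss t j z) ` {j. j \<in> {1..S t} \<and> loss t j z < v})"
      have "m < v" using ne by (simp add: m_def)
      moreover have "\<exists>v\<in>V. v \<le> m"
        using neg by (intro attained[of "\<lambda>j. loss t j z < v"]) (auto simp: m_def VaR intro!: Max_ge)
      ultimately show False using least by force
    qed
  qed auto
qed

lemma VaR_tail_weights:
  assumes "\<beta> \<in> {\<alpha> - \<gamma>..\<alpha>}"
  obtains q where "tail_weights \<beta> t z (VaR t z) q"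
  using tail_weights_exist[of t z "VaR t z" \<beta>] VaR_quantile[where t=t and z=z] assms by auto

lemma \<psi>_eq_at_VaR:
  assumes "\<beta> \<in> {\<alpha> - \<gamma>..\<alpha>}"
  shows "\<psi> \<beta> t z = cvar_objective \<beta> t z (VaR t z)"
proof -
  obtain q where "tail_weights \<beta> t z (VaR t z) q" using VaR_tail_weights[OF assms] .
  moreover have "\<beta> < 1" using assms \<alpha> by simp
  ultimately show ?thesis by (simp add: \<psi>_eq_cvar_objective)
qed

lemma convex_\<psi>:
  assumes \<beta>: "\<beta> \<in> {\<alpha> - \<gamma>..\<alpha>}"
  shows "convex_on UNIV (\<psi> \<beta> t)"
proof (rule convex_on_subdifferential)
  fix z
  obtain q where q: "tail_weights \<beta> t z (VaR t z) q" using VaR_tail_weights[OF \<beta>] .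
  have "\<beta> < 1" using \<beta> \<alpha> by simp
  then have "tail_gradient \<beta> t q \<in> subdifferential (\<psi> \<beta> t) z"
    using cvar_objective_lower_bound[OF _ q] by (simp add: subdifferential_def \<psi>_eq_at_VaR[OF \<beta>])
  then show "subdifferential (\<psi> \<beta> t) z \<noteq> {}" by auto
qed

text \<open>Both CVaRs are attained at \<open>VaR t z\<close> and share the expected excess
  \<open>?e\<close>. Its factors \<open>A / (1 - \<alpha> + \<gamma>)\<close> and
  \<open>B / (1 - \<alpha>)\<close> both equal \<open>1 / \<gamma>\<close> and cancel, while
  \<open>A - B = 1\<close>.\<close>

lemma VaR_dc: "VaR t z = A * \<psi> (\<alpha> - \<gamma>) t z - B * \<psi> \<alpha> t z"
proof -
  let ?e = "\<Sum>j=1..S t. p t j * max (loss t j z - VaR t z) 0"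
  have \<psi>: "\<psi> \<beta> t z = VaR t z + 1 / (1 - \<beta>) * ?e" if "\<beta> \<in> {\<alpha> - \<gamma>..\<alpha>}" for \<beta>
    using \<psi>_eq_at_VaR[OF that] by (simp add: cvar_objective_def)
  have "A * (1 / (1 - (\<alpha> - \<gamma>))) = 1 / \<gamma>" "B * (1 / (1 - \<alpha>)) = 1 / \<gamma>"
    using \<alpha> \<gamma>_pos by (auto simp: A_def B_def field_simps)
  moreover have "a * (v + k * e) - b * (v + l * e) = (a - b) * v + (a * k - b * l) * e" for a b k l v e :: real
    by (simp add: algebra_simps)
  moreover have "A - B = 1" using \<gamma>_pos by (simp add: A_def B_def field_simps)
  moreover have "\<psi> (\<alpha> - \<gamma>) t z = VaR t z + 1 / (1 - (\<alpha> - \<gamma>)) * ?e"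
    "\<psi> \<alpha> t z = VaR t z + 1 / (1 - \<alpha>) * ?e"
    using \<gamma>_pos by (intro \<psi>, simp)+
  ultimately show ?thesis by (simp only:) simp
qed

text \<open>In each period, \<open>max (a - b - \<tau>) 0 = max (a - \<tau>) b - b\<close> for the
  two scaled CVaRs \<open>a\<close> and \<open>b\<close>.\<close>

lemma \<Phi>_dc: "\<Phi> \<rho> x = G \<rho> x - H \<rho> x"
proof -
  have "R x = (\<Sum>t\<in>UNIV. max (A * \<psi> (\<alpha> - \<gamma>) t (x $ t) - \<tau>) (B * \<psi> \<alpha> t (x $ t)) - B * \<psi> \<alpha> t (x $ t))"
    unfolding R_def VaR_def[symmetric] VaR_dc by (intro sum.cong) auto
  then show ?thesis
    by (simp add: \<Phi>_def G_def H_def sum_subtractf sum_distrib_left[symmetric] right_diff_distrib)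
qed

section \<open>Convexity and subgradients of the DC components\<close>

lemma A_B_nonneg: "0 \<le> A" "0 \<le> B"
  using \<alpha> \<gamma>_pos by (auto simp: A_def B_def)

lemma convex_\<psi>_block:
  assumes "\<beta> \<in> {\<alpha> - \<gamma>..\<alpha>}"
  shows "convex_on UNIV (\<lambda>x :: (real^'n, 't) vec. \<psi> \<beta> t (x $ t))"
  using convex_\<psi>[OF assms, of t] by (simp add: convex_on_def)

text \<open>The subtracted square cancels the regulariser of \<open>f\<close>; linear terms,
  weighted absolute values and maxima of convex functions remain. Thus \<open>G\<close> is strongly
  convex.\<close>

lemma convex_G_minus_square:
  assumes "\<rho> > 0"
  shows "convex_on UNIV (\<lambda>x. G \<rho> x - lam2 * (norm x)\<^sup>2)"
proof -
  have lin: "linear (\<lambda>x :: (real^'n, 't) vec. \<Sum>t\<in>UNIV. - (\<mu> t) \<bullet> x $ t)"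
    by (rule linearI) (simp_all add: inner_simps sum.distrib sum_distrib_left sum_negf sum_subtractf)
  have diff: "linear (\<lambda>x :: (real^'n, 't) vec. x $ t $ i - x $ t' $ i)" for t t' i
    by (rule linearI) (simp_all add: algebra_simps)
  \<comment> \<open>Writing \<open>+ -\<close> and \<open>+ 0\<close> gives the terms the shape of
    \<open>convex_on_add\<close> and \<open>convex_on_abs_linear\<close>.\<close>
  have eq: "G \<rho> x - lam2 * (norm x)\<^sup>2 =
     (\<Sum>t\<in>UNIV. - (\<mu> t) \<bullet> x $ t)
     + lam1 * ((\<Sum>i\<in>UNIV. c $ i * \<bar>x $ Min UNIV $ i + - (w_prev $ i)\<bar>)
             + (\<Sum>t\<in>UNIV - {Min UNIV}. \<Sum>i\<in>UNIV. c $ i * \<bar>(x $ t $ i - x $ Max {s. s < t} $ i) + 0\<bar>))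
     + \<rho> * (\<Sum>t\<in>UNIV. max (A * \<psi> (\<alpha> - \<gamma>) t (x $ t) + - \<tau>) (B * \<psi> \<alpha> t (x $ t)))" for x
    by (simp add: G_def f_def sum_norm_blocks sum_negf)
  have "convex_on UNIV (\<lambda>x :: (real^'n, 't) vec. - \<tau>)"
    by (simp add: convex_on_def algebra_simps flip: distrib_right)
  moreover have "linear (\<lambda>x :: (real^'n, 't) vec. x $ t $ i)" for t i
    by (rule linearI) simp_all
  ultimately show ?thesis
    unfolding eq using assms lam1 c \<gamma>_pos A_B_nonneg
    by (intro convex_on_add convex_on_cmul convex_on_sum_fun convex_on_linear[OF lin]
        convex_on_max convex_\<psi>_block convex_on_abs_linear diff) auto
qed

lemma convex_G:
  assumes "\<rho> > 0"
  shows "convex_on UNIV (G \<rho>)"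
proof -
  have "convex_on UNIV (\<lambda>x. (G \<rho> x - lam2 * (norm x)\<^sup>2) + lam2 * (norm x)\<^sup>2)"
    using lam2 by (intro convex_on_add convex_G_minus_square convex_on_cmul convex_norm_square assms) auto
  then show ?thesis by simp
qed

lemma convex_H:
  assumes "\<rho> > 0"
  shows "convex_on UNIV (H \<rho>)"
  unfolding H_def using assms A_B_nonneg \<gamma>_pos
  by (intro convex_on_cmul convex_on_sum_fun convex_\<psi>_block) auto

lemma continuous_G: "\<rho> > 0 \<Longrightarrow> continuous_on UNIV (G \<rho>)"
  and continuous_H: "\<rho> > 0 \<Longrightarrow> continuous_on UNIV (H \<rho>)"
  using convex_on_continuous[OF open_UNIV] convex_G convex_H by blast+

text \<open>The infimum at \<open>z'\<close> is attained at \<open>VaR t z'\<close>, where the lower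
  bound for the objective applies. Weights in \<open>[0, 1]\<close> give a norm bound independent of
  \<open>z\<close>, from which a convergent subsequence is extracted later.\<close>

lemma cvar_subgradient:
  assumes "is_cvar_subgradient t z g"
  shows "\<psi> \<alpha> t z + g \<bullet> (z' - z) \<le> \<psi> \<alpha> t z'"
    and "norm g \<le> 1 / (1 - \<alpha>) * (\<Sum>j=1..S t. p t j * norm (r t j))"
proof -
  obtain u q where q: "tail_weights \<alpha> t z u q" and g: "g = tail_gradient \<alpha> t q"
    using assms by (auto simp: is_cvar_subgradient_def tail_weights_def tail_gradient_def)
  have "\<psi> \<alpha> t z' = cvar_objective \<alpha> t z' (VaR t z')" using \<gamma>_pos by (intro \<psi>_eq_at_VaR) simp
  then show "\<psi> \<alpha> t z + g \<bullet> (z' - z) \<le> \<psi> \<alpha> t z'"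
    using cvar_objective_lower_bound[OF \<alpha>(2) q] \<psi>_eq_cvar_objective[OF \<alpha>(2) q] g by simp
  have "norm (\<Sum>j=1..S t. (p t j * q j) *\<^sub>R r t j) \<le> (\<Sum>j=1..S t. p t j * norm (r t j))"
  proof (rule sum_norm_le)
    fix j
    assume j: "j \<in> {1..S t}"
    then have "p t j * q j * norm (r t j) \<le> p t j * 1 * norm (r t j)"
      using tail_weights_bounds[OF q] p_nonneg by (intro mult_right_mono mult_left_mono) auto
    then show "norm ((p t j * q j) *\<^sub>R r t j) \<le> p t j * norm (r t j)"
      using tail_weights_bounds[OF q j] p_nonneg[OF j] by simp
  qed
  then have "1 / (1 - \<alpha>) * norm (\<Sum>j=1..S t. (p t j * q j) *\<^sub>R r t j)
      \<le> 1 / (1 - \<alpha>) * (\<Sum>j=1..S t. p t j * norm (r t j))"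
    using \<alpha> by (intro mult_left_mono) auto
  then show "norm g \<le> 1 / (1 - \<alpha>) * (\<Sum>j=1..S t. p t j * norm (r t j))"
    using \<alpha> by (simp add: g tail_gradient_def)
qed

definition subgradient_bound :: "real \<Rightarrow> real" where
  "subgradient_bound \<rho> = \<rho> * B * (\<Sum>t\<in>UNIV. 1 / (1 - \<alpha>) * (\<Sum>j=1..S t. p t j * norm (r t j)))"

lemma H_subgradient:
  fixes g :: "(real^'n, 't) vec"
  assumes \<rho>: "\<rho> > 0" and g: "\<And>t. is_cvar_subgradient t (w $ t) (g $ t)"
  shows "(\<rho> * B) *\<^sub>R g \<in> subdifferential (H \<rho>) w"
    and "norm ((\<rho> * B) *\<^sub>R g) \<le> subgradient_bound \<rho>"
proof -
  have \<rho>B: "0 \<le> \<rho> * B" using \<rho> A_B_nonneg by simp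
  have "H \<rho> w + ((\<rho> * B) *\<^sub>R g) \<bullet> (y - w) \<le> H \<rho> y" for y
  proof -
    have "H \<rho> w + ((\<rho> * B) *\<^sub>R g) \<bullet> (y - w)
        = \<rho> * B * (\<Sum>t\<in>UNIV. \<psi> \<alpha> t (w $ t) + g $ t \<bullet> (y $ t - w $ t))"
      by (simp add: H_def inner_vec_def[of g] sum.distrib distrib_left)
    also have "\<dots> \<le> H \<rho> y"
      unfolding H_def using g by (intro mult_left_mono[OF _ \<rho>B] sum_mono cvar_subgradient) auto
    finally show ?thesis .
  qed
  then show "(\<rho> * B) *\<^sub>R g \<in> subdifferential (H \<rho>) w" by (simp add: subdifferential_def)
  have "norm g \<le> (\<Sum>t\<in>UNIV. norm (g $ t))"
    by (simp add: norm_vec_def L2_set_le_sum)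
  also have "\<dots> \<le> (\<Sum>t\<in>UNIV. 1 / (1 - \<alpha>) * (\<Sum>j=1..S t. p t j * norm (r t j)))"
    using cvar_subgradient(2)[OF g] by (intro sum_mono)
  finally have "\<rho> * B * norm g \<le> subgradient_bound \<rho>"
    unfolding subgradient_bound_def by (rule mult_left_mono[OF _ \<rho>B])
  then show "norm ((\<rho> * B) *\<^sub>R g) \<le> subgradient_bound \<rho>"
    using \<rho>B by (simp only: norm_scaleR abs_of_nonneg)
qed

section \<open>Convergence of the algorithm\<close>

lemma extrapolated_point_props:
  assumes "x \<in> feasible"
  shows "extrapolated_point \<rho> \<theta> x_old x \<in> feasible"
    and "\<Phi> \<rho> (extrapolated_point \<rho> \<theta> x_old x) \<le> \<Phi> \<rho> x"
proof -
  have "closest_point feasible z \<in> feasible" for z :: "(real^'n, 't) vec"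
    using closest_point_in_set[OF compact_imp_closed[OF compact_feasible]] assms by blast
  then show "extrapolated_point \<rho> \<theta> x_old x \<in> feasible"
    and "\<Phi> \<rho> (extrapolated_point \<rho> \<theta> x_old x) \<le> \<Phi> \<rho> x"
    using assms by (auto simp: extrapolated_point_def Let_def)
qed

text \<open>\<open>GREATEST\<close> is attained: the admissible step lengths are closed, contain 1,
  and are bounded because \<open>d\<close> is nonzero and the feasible set is bounded.\<close>

lemma max_step_props:
  fixes w d :: "(real^'n, 't) vec"
  assumes wd: "w + d \<in> feasible" and d: "d \<noteq> 0"
  shows "1 \<le> max_step w d" and "w + max_step w d *\<^sub>R d \<in> feasible"
proof -
  let ?P = "\<lambda>l. l \<ge> 1 \<and> w + l *\<^sub>R d \<in> feasible"
  have "closed {l. ?P l}"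
  proof -
    have "closed ((\<lambda>l. w + l *\<^sub>R d) -` feasible)"
      by (intro closed_vimage compact_imp_closed compact_feasible continuous_intros)
    then have "closed ({1..} \<inter> (\<lambda>l. w + l *\<^sub>R d) -` feasible)" by (intro closed_Int) auto
    then show ?thesis by (simp add: Collect_conj_eq vimage_def atLeast_def)
  qed
  moreover have "bounded {l. ?P l}"
  proof -
    obtain b where b: "\<And>z :: (real^'n, 't) vec. z \<in> feasible \<Longrightarrow> norm z \<le> b"
      using compact_imp_bounded[OF compact_feasible] by (auto simp: bounded_iff)
    have "norm l \<le> (b + norm w) / norm d" if "?P l" for l
    proof -
      have "norm (l *\<^sub>R d) \<le> norm (w + l *\<^sub>R d) + norm w"
        by (metis add_diff_cancel_left' norm_triangle_ineq4)
      then show ?thesis using b[of "w + l *\<^sub>R d"] that d by (simp add: field_simps)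
    qed
    then show ?thesis by (intro boundedI) auto
  qed
  ultimately have "compact {l. ?P l}" by (simp add: compact_eq_bounded_closed)
  moreover have "1 \<in> {l. ?P l}" using wd by simp
  ultimately obtain m where m: "?P m" "\<And>l. ?P l \<Longrightarrow> l \<le> m"
    using compact_attains_sup[of "{l. ?P l}"] by (metis (mono_tags, lifting) empty_iff mem_Collect_eq)
  then have "max_step w d = m" unfolding max_step_def by (intro Greatest_equality) auto
  then show "1 \<le> max_step w d" "w + max_step w d *\<^sub>R d \<in> feasible" using m by auto
qed

text \<open>The loop exits at step 1, which is \<open>y\<close> itself, or at a point no worse than
  \<open>y\<close>; both inherit the descent at \<open>y\<close>.\<close>

lemma line_search_props:
  fixes w y :: "(real^'n, 't) vec"
  assumes wy: "w \<in> feasible" "y \<in> feasible" "y \<noteq> w" and \<eta>: "0 < \<eta>" "\<eta> < 1" and lam_bar: "lam_bar > 1"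
    and \<sigma>: "\<sigma> > 0" and descent: "\<Phi> \<rho> y \<le> \<Phi> \<rho> w - \<sigma> * (norm (y - w))\<^sup>2"
  defines "l \<equiv> line_search \<rho> \<sigma> \<eta> lam_bar w y"
  shows "1 \<le> l" "l \<le> lam_bar" "w + l *\<^sub>R (y - w) \<in> feasible"
    and "\<Phi> \<rho> (w + l *\<^sub>R (y - w)) \<le> \<Phi> \<rho> w - \<sigma> * (norm (y - w))\<^sup>2"
proof -
  let ?d = "y - w"
  let ?m = "max_step w ?d"
  let ?b = "\<lambda>l. l > 1 \<and> \<Phi> \<rho> (w + l *\<^sub>R ?d) > min (\<Phi> \<rho> y) (\<Phi> \<rho> w - \<sigma> * l\<^sup>2 * (norm ?d)\<^sup>2)"
  have m: "1 \<le> ?m" "w + ?m *\<^sub>R ?d \<in> feasible"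
    using max_step_props[of w ?d] wy by auto
  have l: "l = while ?b (\<lambda>l. max 1 (\<eta> * l)) (min lam_bar ?m)"
    by (simp add: l_def line_search_def Let_def)
  have "1 \<le> l" "l \<le> min lam_bar ?m" "\<not> ?b l"
    unfolding l using while_backtracking[OF \<eta>, of ?b "min lam_bar ?m"] m lam_bar by auto
  then show "1 \<le> l" "l \<le> lam_bar" by auto
  \<comment> \<open>As \<open>l\<close> is at most \<open>?m\<close>, the new point lies on the
    segment from \<open>w\<close> to the farthest feasible point of the ray.\<close>
  have "w + l *\<^sub>R ?d = (1 - l / ?m) *\<^sub>R w + (l / ?m) *\<^sub>R (w + ?m *\<^sub>R ?d)"
    using m(1) by (simp add: algebra_simps)
  also have "\<dots> \<in> feasible"
    using m wy \<open>1 \<le> l\<close> \<open>l \<le> min lam_bar ?m\<close> by (intro convexD_alt[OF convex_feasible]) auto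
  finally show "w + l *\<^sub>R ?d \<in> feasible" .
  show "\<Phi> \<rho> (w + l *\<^sub>R ?d) \<le> \<Phi> \<rho> w - \<sigma> * (norm ?d)\<^sup>2"
  proof (cases "l = 1")
    case True
    then show ?thesis using descent by simp
  next
    case False
    then have "\<Phi> \<rho> (w + l *\<^sub>R ?d) \<le> \<Phi> \<rho> y" using \<open>\<not> ?b l\<close> \<open>1 \<le> l\<close> by auto
    then show ?thesis using descent by simp
  qed
qed

text \<open>Strong convexity contributes \<open>lam2 + \<nu> / 2\<close> and the subgradient inequality \<open>\<nu> / 2\<close>.\<close>

lemma subproblem_descent:
  assumes \<rho>: "\<rho> > 0" and w: "w \<in> feasible" and y: "y \<in> feasible"
    and s: "s \<in> subdifferential (H \<rho>) w"
    and min: "\<And>z. z \<in> feasible \<Longrightarrow>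
      G_hat \<rho> \<nu> y - (s + \<nu> *\<^sub>R w) \<bullet> y \<le> G_hat \<rho> \<nu> z - (s + \<nu> *\<^sub>R w) \<bullet> z"
  shows "\<Phi> \<rho> y \<le> \<Phi> \<rho> w - (lam2 + \<nu>) * (norm (y - w))\<^sup>2"
proof -
  let ?u = "s + \<nu> *\<^sub>R w" and ?c = "lam2 + \<nu> / 2"
  define F where "F z = (G \<rho> z - lam2 * (norm z)\<^sup>2) + (- ?u) \<bullet> z" for z
  have "linear (\<lambda>z. (- ?u) \<bullet> z)" by (rule linearI) (simp_all add: inner_simps)
  then have "convex_on UNIV F"
    unfolding F_def by (intro convex_on_add convex_G_minus_square convex_on_linear \<rho>)
  then have "convex_on feasible F" using convex_feasible by (rule convex_on_subset[OF _ subset_UNIV])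
  moreover have F: "F z + ?c * (norm z)\<^sup>2 = G_hat \<rho> \<nu> z - ?u \<bullet> z" for z
    by (simp add: F_def G_hat_def algebra_simps)
  ultimately have "F y + ?c * (norm y)\<^sup>2 + ?c * (norm (w - y))\<^sup>2 \<le> F w + ?c * (norm w)\<^sup>2"
    using minimizer_quadratic_growth[OF convex_feasible _ y w, of F ?c] min by simp
  then have growth: "G_hat \<rho> \<nu> y - ?u \<bullet> y + ?c * (norm (y - w))\<^sup>2 \<le> G_hat \<rho> \<nu> w - ?u \<bullet> w"
    by (simp only: F norm_minus_commute)
  have "H \<rho> w + s \<bullet> (y - w) \<le> H \<rho> y" using s by (simp add: subdifferential_def)
  \<comment> \<open>The linear part of this expansion around \<open>w\<close> cancels the
    \<open>\<nu>\<close> part of \<open>?u\<close>; the square supplies a further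
    \<open>\<nu> / 2\<close>.\<close>
  moreover have "\<nu> / 2 * (norm y)\<^sup>2 - \<nu> / 2 * (norm w)\<^sup>2 = \<nu> * (w \<bullet> (y - w)) + \<nu> / 2 * (norm (y - w))\<^sup>2"
    by (simp add: power2_norm_eq_inner inner_simps inner_commute algebra_simps)
  ultimately show ?thesis
    using growth by (simp add: \<Phi>_dc G_hat_def inner_simps algebra_simps)
qed

text \<open>Isolates what the limit argument uses of an iteration, free of the extrapolation, the
  CVaR weights and the line search loop.\<close>

definition step_certificate ::
    "real \<Rightarrow> real \<Rightarrow> real \<Rightarrow> real \<Rightarrow> (real^'n, 't) vec \<Rightarrow> (real^'n, 't) vec \<Rightarrow>
     (real^'n, 't) vec \<Rightarrow> (real^'n, 't) vec \<Rightarrow> (real^'n, 't) vec \<Rightarrow> real \<Rightarrow> bool" where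
  "step_certificate \<rho> \<nu> \<sigma> lam_bar x x_new w y s l \<longleftrightarrow>
     s \<in> subdifferential (H \<rho>) w \<and> norm s \<le> subgradient_bound \<rho> \<and>
     (\<forall>z\<in>feasible. G_hat \<rho> \<nu> y - (s + \<nu> *\<^sub>R w) \<bullet> y \<le> G_hat \<rho> \<nu> z - (s + \<nu> *\<^sub>R w) \<bullet> z) \<and>
     1 \<le> l \<and> l \<le> lam_bar \<and> x_new = w + l *\<^sub>R (y - w) \<and> x_new \<in> feasible \<and>
     \<Phi> \<rho> x_new \<le> \<Phi> \<rho> x - \<sigma> * (norm (y - w))\<^sup>2"

lemma iBDCA_step_certificate:
  assumes step: "iBDCA_step \<rho> \<theta> \<nu> \<sigma> \<eta> lam_bar \<epsilon>_tol x_old x x_new" and x: "x \<in> feasible"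
    and \<rho>: "\<rho> > 0" and \<sigma>: "0 < \<sigma>" "\<sigma> < lam2 + \<nu>" and \<eta>: "0 < \<eta>" "\<eta> < 1" and lam_bar: "lam_bar > 1"
  shows "\<exists>w y s l. step_certificate \<rho> \<nu> \<sigma> lam_bar x x_new w y s l"
proof -
  obtain w g y where w: "w = extrapolated_point \<rho> \<theta> x_old x"
    and g: "\<And>t. is_cvar_subgradient t (w $ t) (g $ t)"
    and y: "is_arg_min (\<lambda>z. G_hat \<rho> \<nu> z - ((\<rho> * B) *\<^sub>R g + \<nu> *\<^sub>R w) \<bullet> z) (\<lambda>z. z \<in> feasible) y"
    and "y \<noteq> w" and x_new: "x_new = w + line_search \<rho> \<sigma> \<eta> lam_bar w y *\<^sub>R (y - w)"
    using step unfolding iBDCA_step_def by auto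
  have wX: "w \<in> feasible" and \<Phi>w: "\<Phi> \<rho> w \<le> \<Phi> \<rho> x"
    unfolding w by (rule extrapolated_point_props[OF x])+
  have yX: "y \<in> feasible" and min: "\<And>z. z \<in> feasible \<Longrightarrow> G_hat \<rho> \<nu> y - ((\<rho> * B) *\<^sub>R g + \<nu> *\<^sub>R w) \<bullet> y
      \<le> G_hat \<rho> \<nu> z - ((\<rho> * B) *\<^sub>R g + \<nu> *\<^sub>R w) \<bullet> z"
    using y by (auto simp: is_arg_min_def not_less)
  note s = H_subgradient[OF \<rho> g]
  have "\<Phi> \<rho> y \<le> \<Phi> \<rho> w - (lam2 + \<nu>) * (norm (y - w))\<^sup>2"
    using \<rho> wX yX s(1) min by (rule subproblem_descent)
  moreover have "\<sigma> * (norm (y - w))\<^sup>2 \<le> (lam2 + \<nu>) * (norm (y - w))\<^sup>2"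
    using \<sigma> by (intro mult_right_mono) auto
  ultimately have "\<Phi> \<rho> y \<le> \<Phi> \<rho> w - \<sigma> * (norm (y - w))\<^sup>2" by linarith
  note ls = line_search_props[OF wX yX \<open>y \<noteq> w\<close> \<eta> lam_bar \<sigma>(1) this]
  have "step_certificate \<rho> \<nu> \<sigma> lam_bar x x_new w y ((\<rho> * B) *\<^sub>R g) (line_search \<rho> \<sigma> \<eta> lam_bar w y)"
    unfolding step_certificate_def x_new using s min ls \<Phi>w by auto
  then show ?thesis by blast
qed

section \<open>Passage to the limit\<close>

lemma dc_critical_point_limit:
  fixes x :: "(real^'n, 't) vec"
  assumes \<rho>: "\<rho> > 0" and x: "x \<in> feasible"
    and w: "w \<longlonglongrightarrow> x" and y: "y \<longlonglongrightarrow> x" and s: "s \<longlonglongrightarrow> v"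
    and sub: "\<And>n. s n \<in> subdifferential (H \<rho>) (w n)"
    and min: "\<And>n z. z \<in> feasible \<Longrightarrow>
      G_hat \<rho> \<nu> (y n) - (s n + \<nu> *\<^sub>R w n) \<bullet> y n \<le> G_hat \<rho> \<nu> z - (s n + \<nu> *\<^sub>R w n) \<bullet> z"
  shows "dc_critical_point feasible (G \<rho>) (H \<rho>) x"
proof -
  let ?u = "v + \<nu> *\<^sub>R x"
  have v: "v \<in> subdifferential (H \<rho>) x"
    using continuous_H[OF \<rho>] w s sub by (rule subdifferential_limit)
  have lim: "G_hat \<rho> \<nu> x - ?u \<bullet> x \<le> G_hat \<rho> \<nu> z - ?u \<bullet> z" if z: "z \<in> feasible" for z
  proof (rule LIMSEQ_le)
    have "continuous_on UNIV (G_hat \<rho> \<nu>)"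
      unfolding G_hat_def by (intro continuous_intros continuous_G \<rho>)
    then have "(\<lambda>n. G_hat \<rho> \<nu> (y n)) \<longlonglongrightarrow> G_hat \<rho> \<nu> x"
      using y by (simp add: continuous_on_tendsto_compose)
    then show "(\<lambda>n. G_hat \<rho> \<nu> (y n) - (s n + \<nu> *\<^sub>R w n) \<bullet> y n) \<longlonglongrightarrow> G_hat \<rho> \<nu> x - ?u \<bullet> x"
      by (intro tendsto_intros w y s)
    show "(\<lambda>n. G_hat \<rho> \<nu> z - (s n + \<nu> *\<^sub>R w n) \<bullet> z) \<longlonglongrightarrow> G_hat \<rho> \<nu> z - ?u \<bullet> z"
      by (intro tendsto_intros w s)
  qed (use min[OF z] in auto)
  define F where "F z = G \<rho> z + (- ?u) \<bullet> z" for z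
  have "linear (\<lambda>z. (- ?u) \<bullet> z)" by (rule linearI) (simp_all add: inner_simps)
  then have "convex_on UNIV F" unfolding F_def by (intro convex_on_add convex_G convex_on_linear \<rho>)
  then have F: "convex_on feasible F" using convex_feasible by (rule convex_on_subset[OF _ subset_UNIV])
  \<comment> \<open>The limiting proximal centre is the minimiser \<open>x\<close> itself, so
    quadratic growth around \<open>x\<close> removes the proximal term exactly.\<close>
  have "G \<rho> x - v \<bullet> x \<le> G \<rho> z - v \<bullet> z" if z: "z \<in> feasible" for z
  proof -
    have "F z + \<nu> / 2 * (norm z)\<^sup>2 = G_hat \<rho> \<nu> z - ?u \<bullet> z" for z
      by (simp add: F_def G_hat_def algebra_simps)
    then have "F x + \<nu> / 2 * (norm x)\<^sup>2 + \<nu> / 2 * (norm (z - x))\<^sup>2 \<le> F z + \<nu> / 2 * (norm z)\<^sup>2"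
      by (intro minimizer_quadratic_growth[OF convex_feasible F x z]) (simp only: lim)
    then show ?thesis
      by (simp add: F_def power2_norm_eq_inner inner_simps inner_commute algebra_simps)
  qed
  then have "v \<in> {a + b | a b. a \<in> subdifferential (G \<rho>) x \<and> b \<in> normal_cone feasible x}"
    using convex_feasible convex_G[OF \<rho>] x by (intro constrained_minimizer_subdifferential)
  then show ?thesis using v x unfolding dc_critical_point_def by blast
qed

lemma accumulation_point_critical:
  assumes \<rho>: "\<rho> > 0" and \<sigma>: "0 < \<sigma>" "\<sigma> < lam2 + \<nu>" and \<eta>: "0 < \<eta>" "\<eta> < 1" and lam_bar: "lam_bar > 1"
    and run: "iBDCA_infinite_run \<rho> \<theta> \<nu> \<sigma> \<eta> lam_bar \<epsilon>_tol x"
    and k: "strict_mono k" and lim: "(x \<circ> k) \<longlonglongrightarrow> x_bar"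
  shows "dc_critical_point feasible (G \<rho>) (H \<rho>) x_bar"
proof -
  have step: "\<exists>w y s l. step_certificate \<rho> \<nu> \<sigma> lam_bar (x i) (x (Suc i)) w y s l" if "x i \<in> feasible" for i
    using run that unfolding iBDCA_infinite_run_def
    by (intro iBDCA_step_certificate[OF _ _ \<rho> \<sigma> \<eta> lam_bar]) auto
  have feas: "x i \<in> feasible" for i
  proof (induction i)
    case 0
    then show ?case using run by (simp add: iBDCA_infinite_run_def)
  next
    case (Suc i)
    then show ?case using step[of i] by (auto simp: step_certificate_def)
  qed
  obtain w y s l where cert: "\<And>i. step_certificate \<rho> \<nu> \<sigma> lam_bar (x i) (x (Suc i)) (w i) (y i) (s i) (l i)"
    using step[OF feas] by metis
  define d where "d i = y i - w i" for i
  have "x_bar \<in> feasible"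
    using closed_sequentially[OF compact_imp_closed[OF compact_feasible] _ lim] feas by simp
  \<comment> \<open>Continuity of \<open>\<Phi>\<close> is read off its DC form, not from the
    definition of the value at risk.\<close>
  obtain m where m: "\<And>z. z \<in> feasible \<Longrightarrow> m \<le> \<Phi> \<rho> z"
  proof -
    have "continuous_on feasible (\<Phi> \<rho>)"
      unfolding \<Phi>_dc using continuous_G[OF \<rho>] continuous_H[OF \<rho>]
      by (intro continuous_intros) (auto elim: continuous_on_subset)
    then show thesis
      using continuous_attains_inf[OF compact_feasible, of "\<Phi> \<rho>"] \<open>x_bar \<in> feasible\<close> that by blast
  qed
  have "(\<lambda>i. \<sigma> * (norm (d i))\<^sup>2) \<longlonglongrightarrow> 0"
  proof (rule decrease_tendsto_zero)
    show "\<Phi> \<rho> (x (Suc i)) \<le> \<Phi> \<rho> (x i) - \<sigma> * (norm (d i))\<^sup>2" for i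
      using cert[of i] unfolding step_certificate_def d_def by blast
  qed (use \<sigma> feas m in auto)
  then have "(\<lambda>i. (norm (d i))\<^sup>2) \<longlonglongrightarrow> 0"
    using \<sigma> tendsto_mult_left[of "\<lambda>i. \<sigma> * (norm (d i))\<^sup>2" 0 sequentially "1 / \<sigma>"] by simp
  then have "(\<lambda>i. norm (d i)) \<longlonglongrightarrow> 0"
    using tendsto_real_sqrt[of "\<lambda>i. (norm (d i))\<^sup>2" 0 sequentially] by simp
  then have d: "d \<longlonglongrightarrow> 0" by (simp add: tendsto_norm_zero_iff)
  \<comment> \<open>The cap \<open>lam_bar\<close> makes the full displacements vanish together with
    the directions.\<close>
  have ld: "(\<lambda>i. l i *\<^sub>R d i) \<longlonglongrightarrow> 0"
  proof (rule Lim_null_comparison)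
    show "\<forall>\<^sub>F i in sequentially. norm (l i *\<^sub>R d i) \<le> lam_bar * norm (d i)"
    proof (intro always_eventually allI)
      fix i
      have "1 \<le> l i" "l i \<le> lam_bar" using cert[of i] by (auto simp: step_certificate_def)
      then show "norm (l i *\<^sub>R d i) \<le> lam_bar * norm (d i)" by (auto intro!: mult_right_mono)
    qed
    show "(\<lambda>i. lam_bar * norm (d i)) \<longlonglongrightarrow> 0"
      using tendsto_mult_left[OF \<open>(\<lambda>i. norm (d i)) \<longlonglongrightarrow> 0\<close>, of lam_bar] by simp
  qed
  \<comment> \<open>The iteration producing \<open>x (k n)\<close>: because of the extrapolation, \<open>w (k n)\<close> need not tend to \<open>x_bar\<close>.\<close>
  define h where "h n = k (Suc n) - 1" for n
  \<comment> \<open>The shift to \<open>Suc n\<close> matters: \<open>k 0\<close> may be 0, whereas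
    \<open>k (Suc n)\<close> is at least \<open>Suc n\<close> and has a predecessor.\<close>
  have Suc_h: "Suc (h n) = k (Suc n)" for n
    using strict_mono_imp_increasing[OF k, of "Suc n"] by (simp add: h_def)
  have h: "strict_mono h"
  proof (rule strict_monoI_Suc)
    fix n
    show "h n < h (Suc n)" using strict_monoD[OF k, of "Suc n" "Suc (Suc n)"] Suc_h[of n] Suc_h[of "Suc n"] by simp
  qed
  \<comment> \<open>The subgradients need not converge along \<open>h\<close>; their uniform bound
    yields a further subsequence along which they do.\<close>
  have "bounded (range (s \<circ> h))"
    using cert by (intro boundedI[of _ "subgradient_bound \<rho>"]) (auto simp: step_certificate_def)
  then obtain v q where q: "strict_mono q" and v: "(s \<circ> h \<circ> q) \<longlonglongrightarrow> v"
    using bounded_imp_convergent_subsequence by blast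
  define j where "j = h \<circ> q"
  have j: "strict_mono j" unfolding j_def using h q by (rule strict_mono_o)
  have "(\<lambda>n. x (Suc (j n))) \<longlonglongrightarrow> x_bar"
  proof -
    have "(\<lambda>n. (x \<circ> k) (Suc n)) \<longlonglongrightarrow> x_bar" using lim by (rule LIMSEQ_Suc)
    then have "((\<lambda>n. (x \<circ> k) (Suc n)) \<circ> q) \<longlonglongrightarrow> x_bar" using q by (rule LIMSEQ_subseq_LIMSEQ)
    then show ?thesis by (simp add: j_def o_def Suc_h)
  qed
  moreover have "(\<lambda>n. l (j n) *\<^sub>R d (j n)) \<longlonglongrightarrow> 0"
    using LIMSEQ_subseq_LIMSEQ[OF ld j] by (simp add: o_def)
  ultimately have "(\<lambda>n. x (Suc (j n)) - l (j n) *\<^sub>R d (j n)) \<longlonglongrightarrow> x_bar - 0" by (rule tendsto_diff)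
  moreover have "w i = x (Suc i) - l i *\<^sub>R d i" for i
    using cert[of i] by (simp add: step_certificate_def d_def)
  ultimately have w: "(\<lambda>n. w (j n)) \<longlonglongrightarrow> x_bar" by simp
  have "(\<lambda>n. w (j n) + d (j n)) \<longlonglongrightarrow> x_bar + 0"
    using LIMSEQ_subseq_LIMSEQ[OF d j] by (intro tendsto_add w) (simp add: o_def)
  then have y: "(\<lambda>n. y (j n)) \<longlonglongrightarrow> x_bar" by (simp add: d_def)
  show ?thesis
  proof (rule dc_critical_point_limit[OF \<rho> \<open>x_bar \<in> feasible\<close> w y])
    show "(\<lambda>n. s (j n)) \<longlonglongrightarrow> v" using v by (simp add: j_def o_def)
  qed (use cert in \<open>auto simp: step_certificate_def\<close>)
qed

end

theorem theorem4p1: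
  fixes M :: "'w measure"
    and \<xi> :: "'t::{finite,linorder} \<Rightarrow> 'w \<Rightarrow> real^'n"
    and S :: "'t \<Rightarrow> nat"
    and r :: "'t \<Rightarrow> nat \<Rightarrow> real^'n"
    and p :: "'t \<Rightarrow> nat \<Rightarrow> real"
    and \<alpha> lam1 lam2 :: real
    and c w_prev :: "real^'n"
    and \<tau> \<gamma> :: real
    and \<rho> \<theta> \<nu> \<sigma> \<eta> lam_bar \<epsilon>_tol :: real
    and x :: "nat \<Rightarrow> (real^'n, 't) vec"
    and x_bar :: "(real^'n, 't) vec"
  assumes "portfolio M \<xi> S r p \<alpha> lam1 lam2 c w_prev \<gamma>"
    and "\<rho> > 0"
    and "0 \<le> \<theta>" "\<theta> < 1"
    and "\<nu> > 0"
    and "0 < \<sigma>" "\<sigma> < lam2 + \<nu>"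
    and "0 < \<eta>" "\<eta> < 1"
    and "lam_bar > 1"
    and "\<epsilon>_tol \<ge> 0"
    and "portfolio.iBDCA_infinite_run M \<xi> S r p \<alpha> lam1 lam2 c w_prev \<tau> \<gamma>
           \<rho> \<theta> \<nu> \<sigma> \<eta> lam_bar \<epsilon>_tol x"
    and "\<exists>k. strict_mono k \<and> (x \<circ> k) \<longlonglongrightarrow> x_bar"
  shows "dc_critical_point feasible
           (portfolio.G S r p \<alpha> lam1 lam2 c w_prev \<tau> \<gamma> \<rho>)
           (portfolio.H S r p \<alpha> \<gamma> \<rho>)
           x_bar"
proof -
  interpret portfolio M \<xi> S r p \<alpha> lam1 lam2 c w_prev \<tau> \<gamma> by fact
  obtain k where "strict_mono k" "(x \<circ> k) \<longlonglongrightarrow> x_bar" using assms(13) by blast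
  then show ?thesis using assms(2-12) by (intro accumulation_point_critical)
qed

end
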